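(* Let $n\geq 1$ be an integer and let $U:\mathbb{R}^n\to\mathbb{R}^n$ be the coordinate unskewing map $$U(\mathbf{x}')=\mathbf{x}'-G_n\Big(\sum_{i=1}^n x'_i\Big)\mathbf{1},\qquad G_n=\frac{1-1/\sqrt{n+1}}{n},$$ where $\mathbf{1}=(1,\ldots,1)\in\mathbb{R}^n$. For each permutation $\pi$ of $\{1,\ldots,n\}$ let $$S'_{\pi}=\{\mathbf{x}'=(x'_1,\ldots,x'_n)\in\mathbb{R}^n : 0\leq x'_{\pi(1)}\leq \cdots \leq x'_{\pi(n)}\leq 1\}$$ be the simplex described in the transformed (skewed) coordinates. Then, in the original coordinate system, all of these simplices are congruent; that is, for any two permutations $\pi,\pi^*$ of $\{1,\ldots,n\}$, the sets $U(S'_\pi)$ and $U(S'_{\pi^*})$ are congruent.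
   Context: Two subsets $A,B$ of $\mathbb{R}^n$ are congruent if there is an isometry $\phi:\mathbb{R}^n\to\mathbb{R}^n$ of Euclidean space (standard Euclidean metric) with $\phi(A)=B$. The skewed (transformed) coordinates $\mathbf{x}'$ of a point with original Cartesian coordinates $\mathbf{x}\in\mathbb{R}^n$ are $\mathbf{x}'=\mathbf{x}+F_n\big(\sum_i x_i\big)\mathbf{1}$ with $F_n=\frac{\sqrt{n+1}-1}{n}$; the map $U$, which takes skewed coordinates back to the original coordinates, is the inverse of this map. *)

theory Defs
  imports "HOL-Analysis.Analysis"
begin

text \<open>
  Euclidean n-space is \<open>real ^ 'n\<close> with \<open>n = CARD('n)\<close>. The class \<open>linorder\<close> on the finite
  index type makes it an order-isomorphic copy of \<open>{1, ..., n}\<close>, so that a permutation of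
  \<open>{1, ..., n}\<close> is a function with \<open>\<pi> permutes UNIV\<close> and chains such as
  \<open>x $ \<pi> 1 \<le> ... \<le> x $ \<pi> n\<close> make sense.
\<close>

definition skew :: "real ^ 'n \<Rightarrow> real ^ 'n" where
  "skew x = x + ((sqrt (real CARD('n) + 1) - 1) / real CARD('n) * (\<Sum>i\<in>UNIV. x $ i)) *\<^sub>R 1"

definition unskew :: "real ^ 'n \<Rightarrow> real ^ 'n" where
  "unskew x = x - ((1 - 1 / sqrt (real CARD('n) + 1)) / real CARD('n) * (\<Sum>i\<in>UNIV. x $ i)) *\<^sub>R 1"

lemma unskew_skew: "unskew (skew x) = x"
proof -
  define n where "n = real CARD('a)"
  define q where "q = sqrt (n + 1)"
  define s where "s = (\<Sum>i\<in>UNIV. x $ i)"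
  have n: "n > 0" and q: "q > 0" by (simp_all add: n_def q_def add_nonneg_pos)
  have "(\<Sum>i\<in>UNIV. skew x $ i) = s + n * ((q - 1) / n * s)"
    unfolding skew_def by (simp add: sum.distrib s_def n_def q_def)
  also have "\<dots> = q * s" using n by (simp add: field_simps)
  finally have "(\<Sum>i\<in>UNIV. skew x $ i) = q * s" .
  then have "unskew (skew x) = skew x - ((1 - 1 / q) / n * (q * s)) *\<^sub>R 1"
    by (simp add: unskew_def n_def q_def)
  also have "(1 - 1 / q) / n * (q * s) = (q - 1) / n * s"
    using n q by (simp add: field_simps)
  finally show ?thesis by (simp add: skew_def n_def q_def s_def)
qed

lemma skew_unskew: "skew (unskew x) = x"
proof -
  define n where "n = real CARD('a)"
  define q where "q = sqrt (n + 1)"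
  define s where "s = (\<Sum>i\<in>UNIV. x $ i)"
  have n: "n > 0" and q: "q > 0" by (simp_all add: n_def q_def add_nonneg_pos)
  have "(\<Sum>i\<in>UNIV. unskew x $ i) = s - n * ((1 - 1 / q) / n * s)"
    unfolding unskew_def by (simp add: sum_subtractf s_def n_def q_def)
  also have "\<dots> = s / q" using n q by (simp add: field_simps)
  finally have "(\<Sum>i\<in>UNIV. unskew x $ i) = s / q" .
  then have "skew (unskew x) = unskew x + ((q - 1) / n * (s / q)) *\<^sub>R 1"
    by (simp add: skew_def n_def q_def)
  also have "(q - 1) / n * (s / q) = (1 - 1 / q) / n * s"
    using q by (simp add: field_simps)
  finally show ?thesis by (simp add: unskew_def n_def q_def s_def)
qed

definition skewed_simplex :: "('n \<Rightarrow> 'n) \<Rightarrow> (real ^ 'n::{finite,linorder}) set" where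
  "skewed_simplex \<pi> =
     {x. (\<forall>i. 0 \<le> x $ \<pi> i \<and> x $ \<pi> i \<le> 1) \<and> (\<forall>i j. i \<le> j \<longrightarrow> x $ \<pi> i \<le> x $ \<pi> j)}"

definition congruent_sets :: "(real ^ 'n) set \<Rightarrow> (real ^ 'n) set \<Rightarrow> bool" where
  "congruent_sets A B \<longleftrightarrow>
     (\<exists>\<phi> :: real ^ 'n \<Rightarrow> real ^ 'n. bij \<phi> \<and> (\<forall>x y. dist (\<phi> x) (\<phi> y) = dist x y) \<and> \<phi> ` A = B)"

end

(* The unskewing map commutes with every permutation of the coordinates, because it only involves
   the coordinate sum and the vector 1. Permuting coordinates is an isometry, and the permutation
   \<pi> \<circ> inv \<pi>' carries one skewed simplex to the other. *)
theory Submission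
  imports Defs
begin

text \<open>Acts by precomposition on indices, so the order of composition reverses: applying
  \<sigma> and then \<tau> is the action of \<open>\<sigma> \<circ> \<tau>\<close>.\<close>

definition permute_coords :: "('n \<Rightarrow> 'n) \<Rightarrow> real ^ 'n \<Rightarrow> real ^ 'n" where
  "permute_coords \<sigma> x = (\<chi> i. x $ \<sigma> i)"

lemma permute_coords_nth [simp]: "permute_coords \<sigma> x $ i = x $ \<sigma> i"
  by (simp add: permute_coords_def)

lemma permute_coords_inverse:
  assumes "bij \<sigma>"
  shows "permute_coords (inv \<sigma>) (permute_coords \<sigma> x) = x"
    and "permute_coords \<sigma> (permute_coords (inv \<sigma>) x) = x"
  using assms by (simp_all add: vec_eq_iff bij_is_surj surj_f_inv_f bij_is_inj)

lemma bij_permute_coords: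
  assumes "bij \<sigma>"
  shows "bij (permute_coords \<sigma>)"
  by (rule o_bij[where g = "permute_coords (inv \<sigma>)"])
    (simp_all add: fun_eq_iff permute_coords_inverse[OF assms])

text \<open>The squared distance is a sum over all coordinates, and \<sigma> merely reindexes
  it.\<close>

lemma dist_permute_coords:
  assumes "bij \<sigma>"
  shows "dist (permute_coords \<sigma> x) (permute_coords \<sigma> y) = dist x y"
  using sum.reindex_bij_betw[OF assms, of "\<lambda>i. (dist (x $ i) (y $ i))\<^sup>2"]
  by (simp add: dist_vec_def L2_set_def)

lemma unskew_permute_coords:
  assumes "bij \<sigma>"
  shows "unskew (permute_coords \<sigma> x) = permute_coords \<sigma> (unskew x)"
  using sum.reindex_bij_betw[OF assms, of "\<lambda>i. x $ i"]
  by (simp add: unskew_def vec_eq_iff)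

text \<open>Entry \<open>\<pi> i\<close> of the permuted vector is entry
  \<open>\<sigma> (\<pi> i)\<close> of the original, so the two chains of inequalities coincide term
  by term.\<close>

lemma permute_coords_skewed_simplex:
  assumes "bij \<sigma>"
  shows "permute_coords \<sigma> ` skewed_simplex (\<sigma> \<circ> \<pi>) = skewed_simplex \<pi>"
proof
  show "permute_coords \<sigma> ` skewed_simplex (\<sigma> \<circ> \<pi>) \<subseteq> skewed_simplex \<pi>"
    by (auto simp: skewed_simplex_def)
  show "skewed_simplex \<pi> \<subseteq> permute_coords \<sigma> ` skewed_simplex (\<sigma> \<circ> \<pi>)"
  proof
    fix x
    assume "x \<in> skewed_simplex \<pi>"
    \<comment> \<open>The preimage of \<open>x\<close>: its entry at
      \<open>\<sigma> (\<pi> i)\<close> is \<open>x $ \<pi> i\<close>, since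
      \<open>inv \<sigma>\<close> cancels \<sigma>.\<close>
    then have "permute_coords (inv \<sigma>) x \<in> skewed_simplex (\<sigma> \<circ> \<pi>)"
      using assms by (simp add: skewed_simplex_def bij_is_inj)
    then show "x \<in> permute_coords \<sigma> ` skewed_simplex (\<sigma> \<circ> \<pi>)"
      by (rule rev_image_eqI) (simp add: permute_coords_inverse[OF assms])
  qed
qed

theorem lemma4:
  fixes \<pi> \<pi>' :: "'n::{finite,linorder} \<Rightarrow> 'n"
  assumes "\<pi> permutes UNIV" and "\<pi>' permutes UNIV"
  shows "congruent_sets (unskew ` skewed_simplex \<pi>) (unskew ` skewed_simplex \<pi>')"
proof -
  \<comment> \<open>The solution of \<open>\<sigma> \<circ> \<pi>' = \<pi>\<close>, the form in
    which the preceding lemma takes its source simplex.\<close>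
  define \<sigma> where "\<sigma> = \<pi> \<circ> inv \<pi>'"
  have \<sigma>: "bij \<sigma>"
    unfolding \<sigma>_def by (intro bij_comp bij_imp_bij_inv assms[THEN permutes_bij])
  have "\<sigma> \<circ> \<pi>' = \<pi>"
    using permutes_inv_o(2)[OF assms(2)] by (simp add: \<sigma>_def comp_assoc)
  then have "permute_coords \<sigma> ` skewed_simplex \<pi> = skewed_simplex \<pi>'"
    using permute_coords_skewed_simplex[OF \<sigma>, of \<pi>'] by simp
  \<comment> \<open>Commuting the permutation past \<open>unskew\<close> turns the equality of
    skewed simplices into one in the original coordinates, where
    \<open>permute_coords \<sigma>\<close> is the required isometry.\<close>
  then have "permute_coords \<sigma> ` unskew ` skewed_simplex \<pi> = unskew ` skewed_simplex \<pi>'"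
    by (metis (no_types, lifting) image_cong image_image unskew_permute_coords[OF \<sigma>])
  then show ?thesis
    unfolding congruent_sets_def
    using bij_permute_coords[OF \<sigma>] dist_permute_coords[OF \<sigma>] by blast
qed

end
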